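(* Let $\mathbf A=\langle A,\to,0\rangle$ be a finite $\mathbf{I}_{2,0}$-chain. Then $\mathbf A\cong\langle[-n,m];\Rightarrow,0\rangle$ for some integers $n,m$ with $0\le n,m\le |A|-1$ and $n+m+1=|A|$.
   Context: A zroupoid is an algebra $\langle A,\to,0\rangle$ with binary $\to$ and constant $0$; $x':=x\to 0$. An implication zroupoid satisfies (I) $(x\to y)\to z\approx[(z'\to x)\to(y\to z)']'$ and $0''\approx 0$; $\mathbf{I}_{2,0}$ is the variety of implication zroupoids satisfying $x''\approx x$. Define $x\sqsubseteq y$ iff $(x\to y')'=x$; an $\mathbf{I}_{2,0}$-chain is a member of $\mathbf{I}_{2,0}$ on which $\sqsubseteq$ is total. Construction: for integers $n,m\ge 0$ let $[-n,m]=\{x\in\mathbb Z:-n\le x\le m\}$ with the usual order $\le$. Define $p:[-n,m]\to[-n,m]$ by $p(x)=x-1$ if $x>-n$ and $p(-n)=-n$. Define $x^\ast$ recursively by $0^\ast=m$, $x^\ast=x$ if $x<0$, and $x^\ast=p\big((p(x))^\ast\big)$ if $x>0$. Define $x\Rightarrow y=\max(x^\ast,y)$ if $x,y\ge 0$, and $x\Rightarrow y=\min(x,y)$ otherwise; the constant is $0\in[-n,m]$. *)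

theory Defs
  imports Main
begin

locale zroupoid =
  fixes A :: "'a set"
    and imp :: "'a \<Rightarrow> 'a \<Rightarrow> 'a"  (infixr "\<rightarrow>" 65)
    and zero :: 'a  ("\<zero>")
  assumes imp_closed: "x \<in> A \<Longrightarrow> y \<in> A \<Longrightarrow> x \<rightarrow> y \<in> A"
    and zero_closed: "\<zero> \<in> A"
begin

definition neg :: "'a \<Rightarrow> 'a" where
  "neg x = x \<rightarrow> \<zero>"

definition sqle :: "'a \<Rightarrow> 'a \<Rightarrow> bool"  (infix "\<sqsubseteq>" 50) where
  "x \<sqsubseteq> y \<longleftrightarrow> neg (x \<rightarrow> neg y) = x"

end

locale implication_zroupoid = zroupoid +
  assumes imp_imp:
      "x \<in> A \<Longrightarrow> y \<in> A \<Longrightarrow> z \<in> A \<Longrightarrow>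
        (x \<rightarrow> y) \<rightarrow> z = neg ((neg z \<rightarrow> x) \<rightarrow> neg (y \<rightarrow> z))"
    and neg_neg_zero: "neg (neg \<zero>) = \<zero>"

locale I20 = implication_zroupoid +
  assumes neg_neg: "x \<in> A \<Longrightarrow> neg (neg x) = x"

locale I20_chain = I20 +
  assumes sqle_total: "x \<in> A \<Longrightarrow> y \<in> A \<Longrightarrow> x \<sqsubseteq> y \<or> y \<sqsubseteq> x"

definition zroupoid_iso ::
    "'a set \<Rightarrow> ('a \<Rightarrow> 'a \<Rightarrow> 'a) \<Rightarrow> 'a \<Rightarrow> 'b set \<Rightarrow> ('b \<Rightarrow> 'b \<Rightarrow> 'b) \<Rightarrow> 'b \<Rightarrow> ('a \<Rightarrow> 'b) \<Rightarrow> bool" where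
  "zroupoid_iso A impA zeroA B impB zeroB f \<longleftrightarrow>
     bij_betw f A B \<and>
     (\<forall>x\<in>A. \<forall>y\<in>A. f (impA x y) = impB (f x) (f y)) \<and>
     f zeroA = zeroB"

definition zroupoid_isomorphic ::
    "'a set \<Rightarrow> ('a \<Rightarrow> 'a \<Rightarrow> 'a) \<Rightarrow> 'a \<Rightarrow> 'b set \<Rightarrow> ('b \<Rightarrow> 'b \<Rightarrow> 'b) \<Rightarrow> 'b \<Rightarrow> bool" where
  "zroupoid_isomorphic A impA zeroA B impB zeroB \<longleftrightarrow>
     (\<exists>f. zroupoid_iso A impA zeroA B impB zeroB f)"

text \<open>The functions below are total on the integers; only their values on the
  interval from \<open>- int n\<close> to \<open>int m\<close> matter. The nonnegative integers
  \<open>n\<close> and \<open>m\<close> are natural numbers.\<close>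

definition seg :: "nat \<Rightarrow> nat \<Rightarrow> int set" where
  "seg n m = {- int n .. int m}"

definition seg_pred :: "nat \<Rightarrow> int \<Rightarrow> int" where
  "seg_pred n x = (if x > - int n then x - 1 else - int n)"

function seg_star :: "nat \<Rightarrow> nat \<Rightarrow> int \<Rightarrow> int" where
  "seg_star n m x =
     (if x = 0 then int m
      else if x < 0 then x
      else seg_pred n (seg_star n m (seg_pred n x)))"
  by pat_completeness auto
termination
  by (relation "measure (\<lambda>(n, m, x). nat x)") (auto simp: seg_pred_def)

declare seg_star.simps [simp del]

definition seg_imp :: "nat \<Rightarrow> nat \<Rightarrow> int \<Rightarrow> int \<Rightarrow> int" where
  "seg_imp n m x y = (if x \<ge> 0 \<and> y \<ge> 0 then max (seg_star n m x) y else min x y)"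

end

(* With meet x y = (x -> y')' and its De Morgan dual join, (I) says that join and meet distribute
   over each other up to a swap of arguments.  On a chain this forces meet and join to be
   commutative, so that x <= y iff meet x y = x is a linear order, the involution fixes every
   element below 0, and it reverses the order of the elements above 0.  The operation is thus
   determined by the order and the position of 0, and the rank function, shifted to
   vanish at 0, is the isomorphism. *)

theory Submission
  imports Defs
begin

section \<open>Distributive laws for meet and join\<close>

context I20
begin

definition meet :: "'a \<Rightarrow> 'a \<Rightarrow> 'a" where
  "meet x y = neg (x \<rightarrow> neg y)"

definition join :: "'a \<Rightarrow> 'a \<Rightarrow> 'a" where
  "join x y = neg (meet (neg x) (neg y))"

definition one :: 'a where
  "one = neg \<zero>"

lemma neg_closed [simp]: "x \<in> A \<Longrightarrow> neg x \<in> A"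
  by (simp add: neg_def imp_closed zero_closed)

lemma meet_closed [simp]: "x \<in> A \<Longrightarrow> y \<in> A \<Longrightarrow> meet x y \<in> A"
  by (simp add: meet_def imp_closed)

lemma join_closed [simp]: "x \<in> A \<Longrightarrow> y \<in> A \<Longrightarrow> join x y \<in> A"
  by (simp add: join_def)

lemma one_closed [simp]: "one \<in> A"
  by (simp add: one_def zero_closed)

lemma neg_one [simp]: "neg one = \<zero>"
  by (simp add: one_def neg_neg_zero)

lemma neg_meet: "x \<in> A \<Longrightarrow> y \<in> A \<Longrightarrow> neg (meet x y) = join (neg x) (neg y)"
  by (simp add: join_def neg_neg)

lemma neg_join: "x \<in> A \<Longrightarrow> y \<in> A \<Longrightarrow> neg (join x y) = meet (neg x) (neg y)"
  by (simp add: join_def neg_neg)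

lemma imp_eq_join: "x \<in> A \<Longrightarrow> y \<in> A \<Longrightarrow> x \<rightarrow> y = join (neg x) y"
  by (simp add: join_def meet_def neg_neg imp_closed)

lemma imp_eq_neg_meet: "x \<in> A \<Longrightarrow> y \<in> A \<Longrightarrow> x \<rightarrow> y = neg (meet x (neg y))"
  by (simp add: meet_def neg_neg imp_closed)

lemma meet_one: "x \<in> A \<Longrightarrow> meet x one = x"
  using neg_neg[of x] by (simp add: meet_def neg_def[symmetric])

lemma join_zero: "x \<in> A \<Longrightarrow> join x \<zero> = x"
  by (simp add: join_def one_def[symmetric] meet_one neg_neg)

lemma join_meet_distrib:
  assumes "x \<in> A" "y \<in> A" "z \<in> A"
  shows "join (meet x y) z = meet (join z x) (join y z)"
proof -
  have "join (meet x y) z = (x \<rightarrow> neg y) \<rightarrow> z"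
    using assms by (simp add: imp_eq_join[of "x \<rightarrow> neg y"] imp_closed meet_def)
  also have "\<dots> = meet (neg z \<rightarrow> x) (neg y \<rightarrow> z)"
    using assms by (simp add: imp_imp meet_def)
  also have "\<dots> = meet (join z x) (join y z)"
    using assms by (simp add: imp_eq_join neg_neg)
  finally show ?thesis .
qed

lemma meet_join_distrib:
  assumes "x \<in> A" "y \<in> A" "z \<in> A"
  shows "meet (join x y) z = join (meet z x) (meet y z)"
proof -
  have "neg (meet (join x y) z) = neg (join (meet z x) (meet y z))"
    using assms join_meet_distrib[of "neg x" "neg y" "neg z"] by (simp add: neg_meet neg_join)
  with assms show ?thesis
    by (metis neg_neg meet_closed join_closed)
qed

text \<open>The argument swap in \<open>join_meet_distrib\<close> turns the right identity into a
  left one: expand \<open>join (meet x one) \<zero>\<close>.\<close>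

lemma zero_join:
  assumes "x \<in> A"
  shows "join \<zero> x = x"
proof -
  have "x = join (meet x one) \<zero>"
    using assms by (simp add: meet_one join_zero)
  also have "\<dots> = join \<zero> x"
    using assms zero_closed join_meet_distrib[of x one \<zero>] by (simp add: join_zero meet_one)
  finally show ?thesis ..
qed

lemma one_meet: "x \<in> A \<Longrightarrow> meet one x = x"
  using zero_join[of "neg x"] by (metis neg_closed neg_join neg_neg one_def zero_closed)

lemma sqle_iff_meet: "x \<sqsubseteq> y \<longleftrightarrow> meet x y = x"
  by (simp add: sqle_def meet_def)

end

section \<open>The linear order of a chain and its involution\<close>

context I20_chain
begin

lemma join_total:
  assumes "x \<in> A" "y \<in> A"
  shows "join x y = x \<or> join y x = y"
  using sqle_total[of "neg x" "neg y"] assms neg_neg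
  by (auto simp: join_def sqle_iff_meet)

lemma meet_idem: "x \<in> A \<Longrightarrow> meet x x = x"
  using sqle_total by (auto simp: sqle_iff_meet)

lemma join_idem: "x \<in> A \<Longrightarrow> join x x = x"
  using join_total by blast

text \<open>Both sides expand to \<open>join (meet x y) x\<close>, one by each distributive
  law.\<close>

lemma meet_join_comm: "x \<in> A \<Longrightarrow> y \<in> A \<Longrightarrow> meet x (join y x) = meet (join y x) x"
  using join_meet_distrib[of x y x] meet_join_distrib[of y x x] by (simp add: meet_idem join_idem)

text \<open>By \<open>join_total\<close>, either \<open>join x y = x\<close> or
  \<open>join y x = y\<close>; substituting this into the matching instance of
  \<open>meet_join_comm\<close> leaves the two meets.\<close>

lemma meet_comm: "x \<in> A \<Longrightarrow> y \<in> A \<Longrightarrow> meet x y = meet y x"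
  using meet_join_comm[of x y] meet_join_comm[of y x] join_total[of x y] by auto

lemma join_comm: "x \<in> A \<Longrightarrow> y \<in> A \<Longrightarrow> join x y = join y x"
  by (simp add: join_def meet_comm[of "neg x" "neg y"])

lemma sqle_refl: "x \<in> A \<Longrightarrow> x \<sqsubseteq> x"
  by (simp add: sqle_iff_meet meet_idem)

lemma sqle_antisym: "x \<in> A \<Longrightarrow> y \<in> A \<Longrightarrow> x \<sqsubseteq> y \<Longrightarrow> y \<sqsubseteq> x \<Longrightarrow> x = y"
  using meet_comm by (simp add: sqle_iff_meet)

lemma sqle_trans:
  assumes xyz: "x \<in> A" "y \<in> A" "z \<in> A" and "x \<sqsubseteq> y" "y \<sqsubseteq> z"
  shows "x \<sqsubseteq> z"
proof (rule ccontr)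
  assume nle: "\<not> x \<sqsubseteq> z"
  \<comment> \<open>Totality gives \<open>z \<sqsubseteq> x\<close>, so the three elements form a
    cycle.\<close>
  have m: "meet x y = x" "meet y x = x" "meet y z = y" "meet z y = y" "meet x z = z" "meet z x = z"
    using assms nle sqle_total[of x z] meet_comm by (auto simp: sqle_iff_meet)
  have "meet (join x y) z = join z y" "meet (join y z) x = join x z" "meet (join x z) y = join x y"
    using xyz m join_comm by (simp_all add: meet_join_distrib)
  \<comment> \<open>Fixing \<open>join x y\<close> as \<open>x\<close> or \<open>y\<close>
    determines the other joins one after another around the cycle; the last equation then identifies
    \<open>x\<close> with \<open>y\<close>.\<close>
  with join_total[of x y] xyz m join_comm have "x = y"
    by metis
  with nle \<open>y \<sqsubseteq> z\<close> show False
    by simp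
qed

text \<open>Both \<open>x\<close> and \<open>neg x\<close> turn out to lie below
  \<open>\<zero>\<close>, so by duality both absorb \<open>one\<close> under join. They are
  comparable, and distributivity then makes the smaller equal to the larger.\<close>

lemma neg_below_zero:
  assumes x: "x \<in> A" and "\<not> \<zero> \<sqsubseteq> x"
  shows "neg x = x"
proof -
  have x0: "meet x \<zero> = x" and ne: "x \<noteq> \<zero>"
    using assms sqle_total zero_closed sqle_refl by (auto simp: sqle_iff_meet)
  \<comment> \<open>Stated for a generic pair because either of \<open>x\<close> and
    \<open>neg x\<close> may be the smaller one.\<close>
  have fixed: "u = v" if "u \<in> A" "v \<in> A" "v = neg u" "u \<sqsubseteq> v" "join u one = u" for u v
  proof -
    have "u = meet (join u one) v"
      using that by (simp add: sqle_iff_meet)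
    also have "\<dots> = join (meet v u) v"
      using that meet_join_distrib[of u one v] by (simp add: one_meet)
    also have "\<dots> = v"
      using that neg_meet[of u v] meet_comm[of u v] neg_neg[of u] join_comm[of u v]
      by (simp add: sqle_iff_meet)
    finally show ?thesis .
  qed
  have x1: "join (neg x) one = neg x"
    using x0 x zero_closed neg_meet[of x \<zero>] by (simp add: one_def)
  have "neg x \<sqsubseteq> \<zero>"
  proof (rule ccontr)
    assume "\<not> neg x \<sqsubseteq> \<zero>"
    then have "meet \<zero> (neg x) = \<zero>"
      using sqle_total[of "neg x" \<zero>] x zero_closed by (simp add: sqle_iff_meet)
    then have "join one x = one"
      using neg_meet[of \<zero> "neg x"] x zero_closed by (simp add: one_def neg_neg)
    \<comment> \<open>Evaluating this meet by distributivity as well gives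
      \<open>join \<zero> x\<close>, that is \<open>x\<close>, which differs from
      \<open>\<zero>\<close>.\<close>
    then have "\<zero> = meet (join one x) \<zero>"
      by (simp add: one_meet zero_closed)
    also have "\<dots> = x"
      using x x0 zero_closed by (simp add: meet_join_distrib meet_one zero_join)
    finally show False
      using ne by simp
  qed
  then have "join x one = x"
    using neg_meet[of "neg x" \<zero>] x zero_closed by (simp add: one_def neg_neg sqle_iff_meet)
  with x1 show ?thesis
    using fixed[of x "neg x"] fixed[of "neg x" x] sqle_total[of x "neg x"] x by (auto simp: neg_neg)
qed

lemma zero_sqle_neg:
  assumes x: "x \<in> A" and "\<zero> \<sqsubseteq> x"
  shows "\<zero> \<sqsubseteq> neg x"
proof (rule ccontr)
  assume n: "\<not> \<zero> \<sqsubseteq> neg x"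
  then have "neg (neg x) = neg x"
    using neg_below_zero x by simp
  with assms n show False
    by (simp add: neg_neg)
qed

text \<open>If the order were not reversed, \<open>join x y\<close> would be \<open>x\<close>. Since
  \<open>join one x = one\<close>, expanding \<open>meet (join one x) y\<close> shows
  \<open>y = join y x\<close>, so \<open>x\<close> and \<open>y\<close> coincide.\<close>

lemma neg_antimono:
  assumes xy: "x \<in> A" "y \<in> A" and "\<zero> \<sqsubseteq> x" "x \<sqsubseteq> y"
  shows "neg y \<sqsubseteq> neg x"
proof (rule ccontr)
  assume n: "\<not> neg y \<sqsubseteq> neg x"
  then have "meet (neg x) (neg y) = neg x"
    using sqle_total[of "neg x" "neg y"] xy by (simp add: sqle_iff_meet)
  then have j: "join x y = x"
    using xy by (simp add: join_def neg_neg)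
  have "meet \<zero> (neg x) = \<zero>"
    using zero_sqle_neg assms by (simp add: sqle_iff_meet)
  then have "join one x = one"
    using neg_meet[of \<zero> "neg x"] xy zero_closed by (simp add: one_def neg_neg)
  then have "y = meet (join one x) y"
    using xy by (simp add: one_meet)
  also have "\<dots> = join y x"
    using assms by (simp add: meet_join_distrib meet_one sqle_iff_meet)
  also have "\<dots> = x"
    using j join_comm xy by simp
  finally show False
    using n xy sqle_refl by simp
qed

end

section \<open>Ranks in a finite chain\<close>

locale finite_I20_chain = I20_chain +
  assumes finite_carrier: "finite A"
begin

definition below :: "'a \<Rightarrow> 'a set" where
  "below x = {y \<in> A. y \<sqsubseteq> x \<and> y \<noteq> x}"

definition above :: "'a \<Rightarrow> 'a set" where
  "above x = {y \<in> A. x \<sqsubseteq> y \<and> y \<noteq> x}"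

definition position :: "'a \<Rightarrow> int" where
  "position x = int (card (below x)) - int (card (below \<zero>))"

lemma finite_below [simp]: "finite (below x)"
  using finite_carrier by (simp add: below_def)

lemma finite_above [simp]: "finite (above x)"
  using finite_carrier by (simp add: above_def)

lemma card_below_above:
  assumes "x \<in> A"
  shows "card (below x) + card (above x) + 1 = card A"
proof -
  have "A = insert x (below x \<union> above x)" "below x \<inter> above x = {}" "x \<notin> below x \<union> above x"
    using assms sqle_total sqle_antisym by (auto simp: below_def above_def)
  then show ?thesis
    by (metis card_Un_disjoint card_insert_disjoint finite_UnI finite_above finite_below Suc_eq_plus1)
qed

lemma position_strict_mono:
  assumes "x \<in> A" "y \<in> A" "x \<sqsubseteq> y" "x \<noteq> y"
  shows "position x < position y"
proof -
  have "below x \<subset> below y"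
    using assms sqle_trans[of _ x y] sqle_antisym[of x y] by (auto simp: below_def)
  then show ?thesis
    by (simp add: position_def psubset_card_mono)
qed

lemma position_le_iff:
  assumes "x \<in> A" "y \<in> A"
  shows "position x \<le> position y \<longleftrightarrow> x \<sqsubseteq> y"
proof (cases "x = y")
  case True
  with assms show ?thesis
    by (simp add: sqle_refl)
next
  case False
  with assms show ?thesis
    using position_strict_mono[of x y] position_strict_mono[of y x] sqle_total[of x y]
      sqle_antisym[of x y] by fastforce
qed

lemma position_zero [simp]: "position \<zero> = 0"
  by (simp add: position_def)

lemma position_meet:
  assumes "x \<in> A" "y \<in> A"
  shows "position (meet x y) = min (position x) (position y)"
  using assms position_le_iff[of x y] position_le_iff[of y x] sqle_total[of x y] meet_comm[of x y]
  by (auto simp: sqle_iff_meet min_def)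

lemma position_neg_above:
  assumes x: "x \<in> A" and zx: "\<zero> \<sqsubseteq> x"
  shows "position (neg x) = int (card (above x))"
proof -
  have inj: "inj_on neg (above x)"
    by (rule inj_on_inverseI[of _ neg]) (simp add: above_def neg_neg)
  \<comment> \<open>Split at \<open>\<zero>\<close>: everything strictly below
    \<open>\<zero>\<close> is included, and the rest is the image of \<open>above x\<close> under
    the order-reversing involution.\<close>
  have "below (neg x) = below \<zero> \<union> neg ` above x"
  proof (intro equalityI subsetI)
    fix y assume "y \<in> below (neg x)"
    then have y: "y \<in> A" "y \<sqsubseteq> neg x" "y \<noteq> neg x"
      by (auto simp: below_def)
    show "y \<in> below \<zero> \<union> neg ` above x"
    proof (cases "\<zero> \<sqsubseteq> y")
      case True
      then have "neg y \<in> above x"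
        using neg_antimono[of y "neg x"] x y neg_neg by (auto simp: above_def)
      then show ?thesis
        using neg_neg[of y] y by (metis UnI2 imageI)
    next
      case False
      then have "y \<in> below \<zero>"
        using y sqle_total[of y \<zero>] zero_closed by (auto simp: below_def)
      then show ?thesis ..
    qed
  next
    fix y assume "y \<in> below \<zero> \<union> neg ` above x"
    then consider "y \<in> below \<zero>" | z where "z \<in> above x" "y = neg z"
      by blast
    then show "y \<in> below (neg x)"
    proof cases
      case 1
      then show ?thesis
        using zero_sqle_neg[OF x zx] x zero_closed sqle_trans[of y \<zero> "neg x"]
          sqle_antisym[of y \<zero>] by (auto simp: below_def)
    next
      case 2
      then show ?thesis
        using neg_antimono[of x z] x zx neg_neg[of x] neg_neg[of z]
        by (auto simp: below_def above_def)
    qed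
  qed
  moreover have "below \<zero> \<inter> neg ` above x = {}"
  proof -
    have "neg z \<notin> below \<zero>" if "z \<in> above x" for z
      using that x zx zero_closed sqle_trans[of \<zero> x z] zero_sqle_neg[of z]
        sqle_antisym[of "neg z" \<zero>] by (auto simp: below_def above_def)
    then show ?thesis
      by auto
  qed
  ultimately have "card (below (neg x)) = card (below \<zero>) + card (above x)"
    using inj by (simp add: card_Un_disjoint card_image)
  then show ?thesis
    by (simp add: position_def)
qed

text \<open>Counting the chain from \<open>x\<close> and from \<open>\<zero>\<close> shows that
  \<open>position x\<close> and the size of \<open>above x\<close> add up to the size of
  \<open>above \<zero>\<close>.\<close>

lemma position_neg:
  assumes "x \<in> A"
  shows "position (neg x) =
    (if 0 \<le> position x then int (card (above \<zero>)) - position x else position x)"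
proof (cases "\<zero> \<sqsubseteq> x")
  case True
  then show ?thesis
    using assms position_le_iff[of \<zero> x] position_neg_above[of x] card_below_above[of x]
      card_below_above[of \<zero>] zero_closed by (simp add: position_def)
next
  case False
  then show ?thesis
    using assms position_le_iff[of \<zero> x] neg_below_zero[of x] zero_closed by simp
qed

lemma position_bij: "bij_betw position A (seg (card (below \<zero>)) (card (above \<zero>)))"
proof -
  have inj: "inj_on position A"
    using position_le_iff sqle_antisym by (intro inj_onI) (metis order_refl)
  have "position ` A \<subseteq> seg (card (below \<zero>)) (card (above \<zero>))"
    using card_below_above card_below_above[OF zero_closed]
    by (fastforce simp: position_def seg_def)
  \<comment> \<open>Equal cardinalities upgrade the inclusion to surjectivity.\<close>
  moreover have "card (position ` A) = card (seg (card (below \<zero>)) (card (above \<zero>)))"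
    using inj card_below_above[OF zero_closed] by (simp add: card_image seg_def)
  ultimately have "position ` A = seg (card (below \<zero>)) (card (above \<zero>))"
    by (intro card_subset_eq) (auto simp: seg_def)
  with inj show ?thesis
    by (simp add: bij_betw_def)
qed

end

section \<open>The operation on the integer interval, and the isomorphism\<close>

lemma seg_star_nonneg: "k \<le> m \<Longrightarrow> seg_star n m (int k) = int m - int k"
proof (induction k)
  case 0
  show ?case
    by (simp add: seg_star.simps)
next
  case (Suc k)
  \<comment> \<open>As \<open>Suc k \<le> m\<close>, the value \<open>int m - int k\<close> is at
    least 1, so \<open>seg_pred\<close> subtracts 1 without being cut off at
    \<open>- int n\<close>.\<close>
  then show ?case
    by (subst seg_star.simps) (simp add: seg_pred_def)
qed

lemma seg_imp_nonneg:
  assumes "0 \<le> x" "x \<le> int m" "0 \<le> y"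
  shows "seg_imp n m x y = max (int m - x) y"
  using assms seg_star_nonneg[of "nat x" m n] by (simp add: seg_imp_def)

context finite_I20_chain
begin

lemma position_imp:
  assumes "x \<in> A" "y \<in> A"
  shows "position (x \<rightarrow> y) =
    seg_imp (card (below \<zero>)) (card (above \<zero>)) (position x) (position y)"
proof -
  \<comment> \<open>The bound on \<open>y\<close> keeps \<open>neg y\<close> nonnegative when
    \<open>y\<close> is, so a negative \<open>position x\<close> is the minimum; the bound on
    \<open>x\<close> is required by \<open>seg_imp_nonneg\<close>.\<close>
  have "position x \<le> int (card (above \<zero>))" "position y \<le> int (card (above \<zero>))"
    using position_bij assms by (auto simp: bij_betw_def seg_def)
  moreover have "position (x \<rightarrow> y) = position (neg (meet x (neg y)))"
    using assms by (simp add: imp_eq_neg_meet)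
  ultimately show ?thesis
    using assms
    \<comment> \<open>For nonnegative positions, reflecting the minimum gives the maximum. Otherwise
      the minimum is negative and the outer \<open>neg\<close> fixes it.\<close>
    by (cases "0 \<le> position x \<and> 0 \<le> position y")
      (auto simp: position_neg position_meet seg_imp_nonneg, auto simp: seg_imp_def)
qed

lemma position_iso:
  "zroupoid_iso A imp \<zero> (seg (card (below \<zero>)) (card (above \<zero>)))
    (seg_imp (card (below \<zero>)) (card (above \<zero>))) 0 position"
  by (simp add: zroupoid_iso_def position_bij position_imp)

end

theorem theorem5p13:
  fixes A :: "'a set" and imp :: "'a \<Rightarrow> 'a \<Rightarrow> 'a" and zero :: 'a
  assumes "I20_chain A imp zero"
    and "finite A"
  shows "\<exists>n m :: nat.
           int n \<le> int (card A) - 1 \<and> int m \<le> int (card A) - 1 \<and> n + m + 1 = card A \<and>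
           zroupoid_isomorphic A imp zero (seg n m) (seg_imp n m) 0"
proof -
  interpret finite_I20_chain A imp zero
    using assms by (simp add: finite_I20_chain_def finite_I20_chain_axioms_def)
  have "card (below zero) + card (above zero) + 1 = card A"
    using card_below_above zero_closed by blast
  moreover have "zroupoid_isomorphic A imp zero (seg (card (below zero)) (card (above zero)))
      (seg_imp (card (below zero)) (card (above zero))) 0"
    using position_iso by (auto simp: zroupoid_isomorphic_def)
  ultimately show ?thesis
    by (intro exI[of _ "card (below zero)"] exI[of _ "card (above zero)"]) auto
qed

end
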